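(* For any $s \le 2^{n-1}$, there exists a constant $c>0$ such that any non-adaptive algorithm which, given query access to a function $f:\mathbb{F}_2^{\,n}\to\mathbb{R}$ with $\|f\|_2^2 = 1\pm\epsilon$, distinguishes with probability at least $2/3$ whether $f$ is Fourier $s$-sparse or $f$ is $\frac13$-far from Fourier $s$-sparse in $\ell_2^2$ (i.e. $\min_{g\in\mathcal F_s}\|f-g\|_2^2\ge \frac13$), must make at least $c\sqrt{s}$ queries to $f$.
   Context: For $f,g:\mathbb{F}_2^{\,n}\to\mathbb{R}$, $\|f-g\|_2^2=\frac{1}{2^n}\sum_{x}(f(x)-g(x))^2$. For $\alpha\in\mathbb{F}_2^{\,n}$, $\chi_\alpha(x)=(-1)^{\sum_i\alpha_ix_i}$ and $\hat f(\alpha)=\frac{1}{2^n}\sum_x f(x)\chi_\alpha(x)$. A function is Fourier $s$-sparse if it has at most $s$ nonzero Fourier coefficients; $\mathcal F_s$ is the class of such functions. A non-adaptive algorithm chooses all its query points before seeing any values of $f$; $\epsilon$ is a small accuracy parameter. *)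

theory Defs
  imports "HOL-Probability.Probability_Mass_Function"
begin

definition cube :: "nat \<Rightarrow> bool list set" where
  "cube n = {x. length x = n}"

definition chi :: "bool list \<Rightarrow> bool list \<Rightarrow> real" where
  "chi a x = (-1) ^ length (filter id (map2 (\<and>) a x))"

definition fourier :: "nat \<Rightarrow> (bool list \<Rightarrow> real) \<Rightarrow> bool list \<Rightarrow> real" where
  "fourier n f a = (\<Sum>x\<in>cube n. f x * chi a x) / 2 ^ n"

definition fourier_sparse :: "nat \<Rightarrow> nat \<Rightarrow> (bool list \<Rightarrow> real) \<Rightarrow> bool" where
  "fourier_sparse n s f \<longleftrightarrow> card {a \<in> cube n. fourier n f a \<noteq> 0} \<le> s"

definition sqdist :: "nat \<Rightarrow> (bool list \<Rightarrow> real) \<Rightarrow> (bool list \<Rightarrow> real) \<Rightarrow> real" where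
  "sqdist n f g = (\<Sum>x\<in>cube n. (f x - g x)^2) / 2 ^ n"

definition far_from_sparse :: "nat \<Rightarrow> nat \<Rightarrow> real \<Rightarrow> (bool list \<Rightarrow> real) \<Rightarrow> bool" where
  "far_from_sparse n s d f \<longleftrightarrow> (\<forall>g. fourier_sparse n s g \<longrightarrow> sqdist n f g \<ge> d)"

text \<open>A randomized non-adaptive algorithm: a distribution over pairs (query list, decision rule
  on the list of answers). All queries are fixed before any value of f is seen.\<close>
type_synonym nonadaptive_alg = "(bool list list \<times> (real list \<Rightarrow> bool)) pmf"

definition accept_prob :: "nonadaptive_alg \<Rightarrow> (bool list \<Rightarrow> real) \<Rightarrow> real" where
  "accept_prob A f = measure_pmf.prob A {(xs, d). d (map f xs)}"

definition uses_at_most :: "nonadaptive_alg \<Rightarrow> nat \<Rightarrow> bool" where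
  "uses_at_most A q \<longleftrightarrow> (\<forall>(xs, d) \<in> set_pmf A. length xs \<le> q)"

definition distinguishes :: "nat \<Rightarrow> nat \<Rightarrow> real \<Rightarrow> nonadaptive_alg \<Rightarrow> bool" where
  "distinguishes n s eps A \<longleftrightarrow>
     (\<forall>f. \<bar>sqdist n f (\<lambda>_. 0) - 1\<bar> \<le> eps \<longrightarrow>
        (fourier_sparse n s f \<longrightarrow> accept_prob A f \<ge> 2/3) \<and>
        (far_from_sparse n s (1/3) f \<longrightarrow> accept_prob A f \<le> 1/3))"

end

theory Submission
  imports Defs
begin

text \<open>Normalised indicators of subcubes \<open>{x. take k x = a}\<close> vanish on all queries unless some query
  lands in the subcube. Since the \<open>2 ^ k\<close> subcubes are disjoint, for some \<open>a\<close> this happens with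
  probability at most \<open>q / 2 ^ k\<close>, and then the algorithm behaves as on the zero function.
  For \<open>2 ^ k \<le> s\<close> the indicator is \<open>s\<close>-sparse, while for \<open>k = n\<close> it is a point mass, whose flat
  spectrum makes it far from \<open>s\<close>-sparse. Comparing the two gives even a lower bound linear in \<open>s\<close>.\<close>

definition subcube_fun :: "nat \<Rightarrow> bool list \<Rightarrow> bool list \<Rightarrow> real" where
  "subcube_fun k a x = (if take k x = a then sqrt (2 ^ k) else 0)"

section \<open>The cube and its recursion on the dimension\<close>

lemma cube_0 [simp]: "cube 0 = {[]}"
  by (auto simp: cube_def)

lemma cube_Suc: "cube (Suc n) = Cons False ` cube n \<union> Cons True ` cube n"
  by (auto simp: cube_def length_Suc_conv image_iff)

lemma finite_cube [simp]: "finite (cube n)"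
  by (induction n) (simp_all add: cube_Suc)

lemma sum_cube_Suc:
  fixes h :: "bool list \<Rightarrow> 'a::comm_monoid_add"
  shows "sum h (cube (Suc n)) = (\<Sum>x\<in>cube n. h (False # x)) + (\<Sum>x\<in>cube n. h (True # x))"
  unfolding cube_Suc by (subst sum.union_disjoint) (auto simp: sum.reindex)

lemma card_cube [simp]: "card (cube n) = 2 ^ n"
proof (induction n)
  case (Suc n)
  have "card (cube (Suc n)) = (\<Sum>x\<in>cube (Suc n). 1)" by simp
  also have "\<dots> = 2 ^ Suc n" unfolding sum_cube_Suc using Suc by simp
  finally show ?case .
qed simp

section \<open>Characters, Fourier coefficients and Parseval's identity\<close>

lemma chi_Nil [simp]: "chi [] x = 1"
  by (simp add: chi_def)

lemma chi_Cons [simp]: "chi (b # a) (c # x) = (if b \<and> c then - chi a x else chi a x)"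
  by (simp add: chi_def)

lemma chi_square [simp]: "(chi a x)\<^sup>2 = 1"
  by (simp add: chi_def flip: power_mult)

text \<open>With \<open>fourier_True\<close>, one butterfly of the fast Walsh-Hadamard transform: a
  coefficient is half the sum or difference of those of the two restrictions in the first
  coordinate. This drives the inductions on \<open>n\<close>.\<close>

lemma fourier_False:
  "fourier (Suc n) h (False # a) =
    (fourier n (\<lambda>x. h (False # x)) a + fourier n (\<lambda>x. h (True # x)) a) / 2"
  by (simp add: fourier_def sum_cube_Suc field_simps)

lemma fourier_True:
  "fourier (Suc n) h (True # a) =
    (fourier n (\<lambda>x. h (False # x)) a - fourier n (\<lambda>x. h (True # x)) a) / 2"
  by (simp add: fourier_def sum_cube_Suc sum_negf field_simps)

lemma fourier_zero [simp]: "fourier n (\<lambda>_. 0) a = 0"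
  by (simp add: fourier_def)

lemma fourier_diff: "fourier n (\<lambda>x. f x - g x) a = fourier n f a - fourier n g a"
  by (simp add: fourier_def left_diff_distrib sum_subtractf diff_divide_distrib)

text \<open>Each butterfly preserves energy up to a factor 1/2, by ((u + v)/2)^2 + ((u - v)/2)^2 =
  (u^2 + v^2)/2.\<close>

lemma parseval: "(\<Sum>a\<in>cube n. (fourier n h a)\<^sup>2) = (\<Sum>x\<in>cube n. (h x)\<^sup>2) / 2 ^ n"
proof (induction n arbitrary: h)
  case 0
  show ?case by (simp add: fourier_def)
next
  case (Suc n)
  have "(\<Sum>a\<in>cube (Suc n). (fourier (Suc n) h a)\<^sup>2) =
      (\<Sum>a\<in>cube n. (fourier (Suc n) h (False # a))\<^sup>2 + (fourier (Suc n) h (True # a))\<^sup>2)"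
    by (simp add: sum_cube_Suc sum.distrib)
  also have "\<dots> = (\<Sum>a\<in>cube n. ((fourier n (\<lambda>x. h (False # x)) a)\<^sup>2
      + (fourier n (\<lambda>x. h (True # x)) a)\<^sup>2) / 2)"
    by (intro sum.cong) (simp_all add: fourier_False fourier_True power2_eq_square field_simps)
  also have "\<dots> = ((\<Sum>a\<in>cube n. (fourier n (\<lambda>x. h (False # x)) a)\<^sup>2)
      + (\<Sum>a\<in>cube n. (fourier n (\<lambda>x. h (True # x)) a)\<^sup>2)) / 2"
    by (simp add: sum.distrib flip: sum_divide_distrib)
  also have "\<dots> = (\<Sum>x\<in>cube (Suc n). (h x)\<^sup>2) / 2 ^ Suc n"
    unfolding Suc sum_cube_Suc by (simp add: field_simps)
  finally show ?case .
qed

section \<open>Norm and spectrum of subcube indicators and point masses\<close>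

lemma sum_subcube:
  fixes c :: real
  assumes "a \<in> cube k" and "k \<le> n"
  shows "(\<Sum>x\<in>cube n. if take k x = a then c else 0) = c * 2 ^ (n - k)"
  using assms
proof (induction n arbitrary: k a)
  case (Suc n)
  show ?case
  proof (cases k)
    case 0
    with Suc.prems have "a = []" by simp
    then show ?thesis using 0 by simp
  next
    case (Suc k')
    with Suc.prems obtain b a' where "a = b # a'" "a' \<in> cube k'"
      by (auto simp: cube_Suc)
    then show ?thesis using Suc.IH[of a' k'] Suc.prems Suc
      by (cases b) (simp_all add: sum_cube_Suc)
  qed
qed (auto simp: cube_def)

lemma sqdist_subcube_fun:
  assumes "a \<in> cube k" and "k \<le> n"
  shows "sqdist n (subcube_fun k a) (\<lambda>_. 0) = 1"
proof -
  have "sqdist n (subcube_fun k a) (\<lambda>_. 0) =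
      (\<Sum>x\<in>cube n. if take k x = a then 2 ^ k else 0) / 2 ^ n"
    unfolding sqdist_def subcube_fun_def by (intro arg_cong2[of _ _ _ _ "(/)"] sum.cong) auto
  also have "\<dots> = 1"
    using assms(2) by (simp add: sum_subcube[OF assms] flip: power_add)
  finally show ?thesis .
qed

text \<open>The indicator ignores all coordinates after the first \<open>k\<close>, so a character
  involving one of them averages to zero. The value \<open>c\<close> is not tied to
  \<open>k\<close>, since the recursion lowers \<open>k\<close> and keeps \<open>c\<close>.\<close>

lemma fourier_subcube_support:
  fixes c :: real
  assumes "a \<in> cube k" and "k \<le> n" and "\<alpha> \<in> cube n"
    and "fourier n (\<lambda>x. if take k x = a then c else 0) \<alpha> \<noteq> 0"
  shows "\<alpha> \<in> (\<lambda>b. b @ replicate (n - k) False) ` cube k"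
  using assms
proof (induction n arbitrary: k a \<alpha>)
  case (Suc n)
  show ?case
  proof (cases k)
    case 0
    with Suc.prems have "a = []" by simp
    \<comment> \<open>For \<open>k = 0\<close> the two restrictions are the same constant, so their
      difference vanishes and a frequency starting with \<open>True\<close> is excluded.\<close>
    with Suc.prems 0 obtain \<beta> where \<beta>: "\<alpha> = False # \<beta>" "\<beta> \<in> cube n"
      by (auto simp: cube_Suc fourier_True)
    with Suc.prems 0 \<open>a = []\<close> have "fourier n (\<lambda>x. c) \<beta> \<noteq> 0"
      by (simp add: fourier_False)
    with Suc.IH[of "[]" 0 \<beta>] \<beta> 0 show ?thesis by simp
  next
    case (Suc k')
    with Suc.prems obtain b a' where a: "a = b # a'" "a' \<in> cube k'"
      by (auto simp: cube_Suc)
    obtain d \<beta> where \<beta>: "\<alpha> = d # \<beta>" "\<beta> \<in> cube n"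
      using Suc.prems by (auto simp: cube_Suc)
    \<comment> \<open>One of the two restrictions is zero, so up to sign the coefficient is half of
      this one.\<close>
    have "fourier n (\<lambda>x. if take k' x = a' then c else 0) \<beta> \<noteq> 0"
      using Suc.prems(4) Suc a \<beta>
      by (cases b; cases d) (auto simp: fourier_False fourier_True)
    with Suc.IH[of a' k' \<beta>] Suc.prems a \<beta> Suc
    obtain e where "e \<in> cube k'" "\<beta> = e @ replicate (n - k') False" by auto
    then have "d # e \<in> cube k" "\<alpha> = (d # e) @ replicate (Suc n - k) False"
      using \<beta> Suc by (auto simp: cube_def)
    then show ?thesis by blast
  qed
qed (auto simp: cube_def)

lemma fourier_sparse_subcube_fun:
  assumes "a \<in> cube k" and "k \<le> n" and "2 ^ k \<le> s"
  shows "fourier_sparse n s (subcube_fun k a)"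
proof -
  let ?emb = "\<lambda>b. b @ replicate (n - k) False"
  have "{\<alpha> \<in> cube n. fourier n (subcube_fun k a) \<alpha> \<noteq> 0} \<subseteq> ?emb ` cube k"
    using fourier_subcube_support[OF assms(1,2)] unfolding subcube_fun_def by blast
  then have "card {\<alpha> \<in> cube n. fourier n (subcube_fun k a) \<alpha> \<noteq> 0} \<le> card (?emb ` cube k)"
    by (intro card_mono) auto
  also have "\<dots> \<le> 2 ^ k"
    using card_image_le[of "cube k" ?emb] by simp
  finally show ?thesis
    using assms(3) by (simp add: fourier_sparse_def)
qed

text \<open>Only the term \<open>x = b\<close> survives, so every coefficient is plus or minus
  \<open>sqrt (2 ^ n) / 2 ^ n\<close>.\<close>

lemma fourier_point_mass_square:
  assumes "b \<in> cube n"
  shows "(fourier n (subcube_fun n b) \<alpha>)\<^sup>2 = 1 / 2 ^ n"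
proof -
  have "(\<Sum>x\<in>cube n. subcube_fun n b x * chi \<alpha> x) =
      (\<Sum>x\<in>cube n. if x = b then sqrt (2 ^ n) * chi \<alpha> b else 0)"
    by (intro sum.cong) (auto simp: subcube_fun_def cube_def)
  also have "\<dots> = sqrt (2 ^ n) * chi \<alpha> b"
    using assms by simp
  finally show ?thesis
    by (simp add: fourier_def power_divide power_mult_distrib power2_eq_square[of "2 ^ n"])
qed

text \<open>At least half of the \<open>2 ^ n\<close> frequencies lie outside the support of
  \<open>g\<close>, and by Parseval each of them contributes \<open>1 / 2 ^ n\<close> to the
  distance. This gives 1/2, more than the required 1/3.\<close>

lemma far_from_sparse_point_mass:
  assumes b: "b \<in> cube n" and n: "1 \<le> n" and s: "s \<le> 2 ^ (n - 1)"
  shows "far_from_sparse n s (1/3) (subcube_fun n b)"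
  unfolding far_from_sparse_def
proof (intro allI impI)
  fix g assume g: "fourier_sparse n s g"
  let ?f = "subcube_fun n b"
  let ?T = "{\<alpha> \<in> cube n. fourier n g \<alpha> \<noteq> 0}"
  have two: "(2::real) ^ n = 2 * 2 ^ (n - 1)"
    using n by (simp flip: power_Suc)
  have "card ?T \<le> 2 ^ (n - 1)"
    using g s by (simp add: fourier_sparse_def)
  then have T: "real (card ?T) \<le> 2 ^ (n - 1)"
    by (metis of_nat_le_iff of_nat_numeral of_nat_power)
  have "card (cube n - ?T) = card (cube n) - card ?T"
    by (intro card_Diff_subset) auto
  moreover have "card ?T \<le> card (cube n)" by (intro card_mono) auto
  ultimately have "real (card (cube n - ?T)) = 2 ^ n - real (card ?T)"
    by (simp add: of_nat_diff)
  with T two have "2 ^ n \<le> 2 * real (card (cube n - ?T))" by linarith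
  then have "1 / 2 \<le> real (card (cube n - ?T)) / 2 ^ n"
    by (simp add: divide_simps)
  also have "\<dots> = (\<Sum>\<alpha>\<in>cube n - ?T. (fourier n (\<lambda>x. ?f x - g x) \<alpha>)\<^sup>2)"
    by (simp add: fourier_diff fourier_point_mass_square[OF b])
  also have "\<dots> \<le> (\<Sum>\<alpha>\<in>cube n. (fourier n (\<lambda>x. ?f x - g x) \<alpha>)\<^sup>2)"
    by (intro sum_mono2) auto
  also have "\<dots> = sqdist n ?f g"
    by (simp add: parseval sqdist_def)
  finally show "1 / 3 \<le> sqdist n ?f g" by simp
qed

section \<open>What few queries fixed in advance can reveal\<close>

text \<open>Couple the two runs through the same draw of queries and decision rule: if
  \<open>f\<close> and \<open>g\<close> agree on all queries, the answers and hence the decisions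
  coincide.\<close>

lemma accept_prob_diff_le:
  "\<bar>accept_prob A f - accept_prob A g\<bar> \<le> measure_pmf.prob A {(xs, d). \<exists>x\<in>set xs. f x \<noteq> g x}"
proof -
  have *: "accept_prob A f \<le> accept_prob A g + measure_pmf.prob A {(xs, d). \<exists>x\<in>set xs. f x \<noteq> g x}"
    for f g
  proof -
    have "d (map g xs)" if "d (map f xs)" "\<forall>x\<in>set xs. f x = g x" for xs d
      using that by (metis map_cong)
    then have "{(xs, d). d (map f xs)} \<subseteq>
        {(xs, d). d (map g xs)} \<union> {(xs, d). \<exists>x\<in>set xs. f x \<noteq> g x}"
      by blast
    then have "accept_prob A f \<le>
        measure_pmf.prob A ({(xs, d). d (map g xs)} \<union> {(xs, d). \<exists>x\<in>set xs. f x \<noteq> g x})"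
      unfolding accept_prob_def by (intro measure_pmf.finite_measure_mono) auto
    also have "\<dots> \<le> accept_prob A g + measure_pmf.prob A {(xs, d). \<exists>x\<in>set xs. f x \<noteq> g x}"
      unfolding accept_prob_def by (intro measure_Un_le) auto
    finally show ?thesis .
  qed
  from *[of f g] *[of g f] show ?thesis
    by (simp add: abs_le_iff eq_commute)
qed

text \<open>The sum of probabilities is the expected number of indices hit. Each query
  \<open>x\<close> hits at most the one index \<open>p x\<close>, so a list of at most
  \<open>q\<close> queries hits at most \<open>q\<close> indices.\<close>

lemma sum_hit_prob_le:
  fixes A :: nonadaptive_alg
  assumes "uses_at_most A q" and "finite I"
  shows "(\<Sum>a\<in>I. measure_pmf.prob A {(xs, d). \<exists>x\<in>set xs. p x = a}) \<le> real q"
proof -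
  let ?E = "\<lambda>a. {(xs, d). \<exists>x\<in>set xs. p x = a} :: (bool list list \<times> (real list \<Rightarrow> bool)) set"
  have int: "integrable (measure_pmf A) (indicator (?E a) :: _ \<Rightarrow> real)" for a
    by (intro measure_pmf.integrable_const_bound[where B = 1]) (auto simp: indicator_def)
  have "(\<Sum>a\<in>I. measure_pmf.prob A (?E a)) =
      measure_pmf.expectation A (\<lambda>z. \<Sum>a\<in>I. indicator (?E a) z)"
    using int by (subst Bochner_Integration.integral_sum) simp_all
  also have "\<dots> \<le> real q"
  proof (rule measure_pmf.integral_le_const)
    show "integrable (measure_pmf A) (\<lambda>z. \<Sum>a\<in>I. indicator (?E a) z :: real)"
      using int by (intro Bochner_Integration.integrable_sum)
    show "AE z in measure_pmf A. (\<Sum>a\<in>I. indicator (?E a) z) \<le> real q"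
    proof (subst AE_measure_pmf_iff, rule ballI)
      fix z assume "z \<in> set_pmf A"
      then obtain xs d where z: "z = (xs, d)" and len: "length xs \<le> q"
        using assms(1) by (cases z) (auto simp: uses_at_most_def)
      have "(\<Sum>a\<in>I. indicator (?E a) z :: real) = (\<Sum>a\<in>I. if a \<in> p ` set xs then 1 else 0)"
        by (intro sum.cong) (auto simp: z indicator_def)
      also have "\<dots> = real (card (I \<inter> p ` set xs))"
        using assms(2) by (simp flip: sum.inter_restrict)
      also have "card (I \<inter> p ` set xs) \<le> card (p ` set xs)"
        by (intro card_mono) auto
      also have "\<dots> \<le> length xs"
        using card_image_le[of "set xs" p] card_length[of xs] by simp
      finally show "(\<Sum>a\<in>I. indicator (?E a) z) \<le> real q"
        using len by simp
    qed
  qed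
  finally show ?thesis .
qed

text \<open>Averaging over the \<open>2 ^ k\<close> subcubes: the hit probabilities sum to at most
  \<open>q\<close>, so one of them is at most the mean.\<close>

lemma subcube_fun_close_to_zero:
  assumes "uses_at_most A q"
  obtains a where "a \<in> cube k"
    "\<bar>accept_prob A (subcube_fun k a) - accept_prob A (\<lambda>_. 0)\<bar> \<le> real q / 2 ^ k"
proof -
  let ?hit = "\<lambda>a. measure_pmf.prob A {(xs, d). \<exists>x\<in>set xs. take k x = a}"
  have "\<exists>a\<in>cube k. ?hit a \<le> real q / 2 ^ k"
  proof (rule ccontr)
    assume "\<not> ?thesis"
    \<comment> \<open>Strictness needs a nonempty cube; the reversed \<open>card_0_eq\<close>
      obtains this from its cardinality.\<close>
    then have "(\<Sum>a\<in>cube k. real q / 2 ^ k) < (\<Sum>a\<in>cube k. ?hit a)"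
      by (intro sum_strict_mono) (auto simp: not_le simp flip: card_0_eq)
    with sum_hit_prob_le[OF assms, of "cube k" "take k"] show False by simp
  qed
  then obtain a where a: "a \<in> cube k" "?hit a \<le> real q / 2 ^ k" by blast
  have eq: "{(xs, d). \<exists>x\<in>set xs. subcube_fun k a x \<noteq> 0} = {(xs, d). \<exists>x\<in>set xs. take k x = a}"
    by (auto simp: subcube_fun_def)
  from order_trans[OF accept_prob_diff_le[of A "subcube_fun k a" "\<lambda>_. 0", unfolded eq] a(2)]
  have "\<bar>accept_prob A (subcube_fun k a) - accept_prob A (\<lambda>_. 0)\<bar> \<le> real q / 2 ^ k" .
  with a(1) show thesis by (rule that)
qed

section \<open>The linear lower bound and its square-root form\<close>

text \<open>A sparse and a far function are both accepted with probability within
  \<open>q / 2 ^ k\<close> of that for the zero function, yet these probabilities must differ by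
  1/3. Hence \<open>2 ^ k \<le> 6 * q\<close>, and rounding \<open>s\<close> to a power of two costs
  another factor 2.\<close>

lemma nonadaptive_linear_lower_bound:
  assumes "0 \<le> eps" and n: "1 \<le> n" and s: "0 < s" "s \<le> 2 ^ (n - 1)"
    and A: "uses_at_most A q" "distinguishes n s eps A"
  shows "real s \<le> 12 * real q"
proof -
  \<comment> \<open>The largest \<open>k\<close> for which subcube indicators are still
    \<open>s\<close>-sparse by the support bound.\<close>
  obtain k where k: "2 ^ k \<le> s" "s < 2 ^ Suc k"
    using ex_power_ivl1[of 2 s] s(1) by auto
  then have "(2::nat) ^ k \<le> 2 ^ (n - 1)" using s(2) by linarith
  then have "k \<le> n - 1" by simp
  then have "k \<le> n" by simp
  obtain a where a: "a \<in> cube k"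
    "\<bar>accept_prob A (subcube_fun k a) - accept_prob A (\<lambda>_. 0)\<bar> \<le> real q / 2 ^ k"
    using subcube_fun_close_to_zero[OF A(1)] .
  \<comment> \<open>The same averaging with subcubes of codimension \<open>n\<close>, that is,
    single points.\<close>
  obtain b where b: "b \<in> cube n"
    "\<bar>accept_prob A (subcube_fun n b) - accept_prob A (\<lambda>_. 0)\<bar> \<le> real q / 2 ^ n"
    using subcube_fun_close_to_zero[OF A(1)] .
  have "2 / 3 \<le> accept_prob A (subcube_fun k a)"
    using A(2) sqdist_subcube_fun[OF a(1) \<open>k \<le> n\<close>] assms(1)
      fourier_sparse_subcube_fun[OF a(1) \<open>k \<le> n\<close> k(1)]
    by (simp add: distinguishes_def)
  moreover have "accept_prob A (subcube_fun n b) \<le> 1 / 3"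
    using A(2) sqdist_subcube_fun[OF b(1) order_refl] assms(1)
      far_from_sparse_point_mass[OF b(1) n s(2)]
    by (simp add: distinguishes_def)
  moreover have "real q / 2 ^ n \<le> real q / 2 ^ k"
    using \<open>k \<le> n\<close> by (intro divide_left_mono) (auto intro: power_increasing)
  ultimately have "1 / 3 \<le> 2 * (real q / 2 ^ k)"
    using a(2) b(2) by linarith
  then have "2 ^ k \<le> 6 * real q"
    by (simp add: field_simps)
  moreover have "real s < 2 * 2 ^ k"
    using k(2) by (metis of_nat_less_iff of_nat_numeral of_nat_power power_Suc)
  ultimately show ?thesis by linarith
qed

theorem theorem4p2:
  shows "\<forall>eps::real. eps > 0 \<longrightarrow>
    (\<exists>c::real. c > 0 \<and>
      (\<forall>(n::nat) (s::nat) (q::nat) (A::nonadaptive_alg).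
         1 \<le> n \<longrightarrow> s \<le> 2 ^ (n - 1) \<longrightarrow>
         uses_at_most A q \<longrightarrow> distinguishes n s eps A \<longrightarrow>
         c * sqrt (real s) \<le> real q))"
\<comment> \<open>The test functions have squared norm exactly 1, so one constant serves every
  \<open>eps\<close>.\<close>
proof (intro allI impI exI[of _ "1 / 12 :: real"] conjI)
  fix eps :: real and n s q :: nat and A :: nonadaptive_alg
  assume "eps > 0" "1 \<le> n" "s \<le> 2 ^ (n - 1)" "uses_at_most A q" "distinguishes n s eps A"
  show "1 / 12 * sqrt (real s) \<le> real q"
  proof (cases "s = 0")
    case False
    with nonadaptive_linear_lower_bound[of eps n s A q] \<open>eps > 0\<close> \<open>1 \<le> n\<close> \<open>s \<le> 2 ^ (n - 1)\<close>
      \<open>uses_at_most A q\<close> \<open>distinguishes n s eps A\<close>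
    have "real s \<le> 12 * real q" by simp
    \<comment> \<open>For \<open>s \<ge> 1\<close> the linear bound implies the square-root
      bound.\<close>
    moreover have "sqrt (real s) \<le> real s"
      using False by (intro real_le_lsqrt) (simp_all add: power2_eq_square)
    ultimately show ?thesis by linarith
  qed simp
qed simp

end
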